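(* For an integer $n\ge 2$: (1) $\kappa(\mathcal{RP}(Q_{4n}))=2$ and $\kappa(\mathcal{RP}^*(Q_{4n}))=1$; (2) $\alpha(\mathcal{RP}(Q_{4n}))\in\{\,2n+\alpha(\mathcal{RP}(\mathbb Z_{2n}))-1,\ 2n+\alpha(\mathcal{RP}(\mathbb Z_{2n}))\,\}$; (3) $\mathcal{RP}(Q_{4n})$ and $\mathcal{RP}^*(Q_{4n})$ are non-Hamiltonian.
   Context: For a group $G$ with identity $e$, the reduced power graph $\mathcal{RP}(G)$ is the simple graph with vertex set $G$ in which $u,v$ are adjacent if and only if $\langle v\rangle\subset\langle u\rangle$ or $\langle u\rangle\subset\langle v\rangle$, where $\subset$ means proper inclusion. The proper reduced power graph $\mathcal{RP}^*(G)$ is the subgraph of $\mathcal{RP}(G)$ induced on $G\setminus\{e\}$. $Q_{4n}=\langle a,b\mid a^{2n}=e=b^4,\ a^n=b^2,\ bab^{-1}=a^{-1}\rangle$ is the quaternion group of order $4n$. The connectivity $\kappa(\Gamma)$ is the minimum number of vertices whose removal results in a disconnected or trivial (one-vertex) graph. The independence number $\alpha(\Gamma)$ is the number of vertices in a maximum independent set. A graph is Hamiltonian if it has a spanning cycle. *)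

theory Defs
  imports "HOL-Algebra.Elementary_Groups" "Graph_Theory.Graph_Theory"
begin

section \<open>Groups given by generators and relations\<close>

datatype 'g letter = Gen 'g | Inv 'g

primrec flip :: "'g letter \<Rightarrow> 'g letter" where
  "flip (Gen x) = Inv x"
| "flip (Inv x) = Gen x"

text \<open>The least congruence on words that contains the free-group cancellations and the
  relations \<open>R\<close>, a pair \<open>(u, v) \<in> R\<close> standing for the relation \<open>u = v\<close>.\<close>

inductive_set word_cong :: "('g letter list \<times> 'g letter list) set \<Rightarrow>
    ('g letter list \<times> 'g letter list) set" for R where
  refl: "(u, u) \<in> word_cong R"
| sym: "(u, v) \<in> word_cong R \<Longrightarrow> (v, u) \<in> word_cong R"
| trans: "(u, v) \<in> word_cong R \<Longrightarrow> (v, w) \<in> word_cong R \<Longrightarrow> (u, w) \<in> word_cong R"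
| cancel: "([x, flip x], []) \<in> word_cong R"
| rel: "(u, v) \<in> R \<Longrightarrow> (u, v) \<in> word_cong R"
| append: "(u, v) \<in> word_cong R \<Longrightarrow> (u', v') \<in> word_cong R \<Longrightarrow> (u @ u', v @ v') \<in> word_cong R"

text \<open>The presented group: its generators are all elements of the type \<open>'g\<close>, its elements are
  the congruence classes of words.\<close>

definition presented_group ::
    "('g letter list \<times> 'g letter list) set \<Rightarrow> 'g letter list set monoid" where
  "presented_group R =
    \<lparr>carrier = UNIV // word_cong R,
     monoid.mult = (\<lambda>X Y. \<Union>u\<in>X. \<Union>v\<in>Y. word_cong R `` {u @ v}),
     one = word_cong R `` {[]}\<rparr>"

lemma equiv_word_cong: "equiv UNIV (word_cong R)"
  by (auto intro!: equivI refl_onI symI transI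
      intro: word_cong.refl word_cong.sym word_cong.trans)

lemma mult_presented_group:
  "word_cong R `` {u} \<otimes>\<^bsub>presented_group R\<^esub> word_cong R `` {v} = word_cong R `` {u @ v}"
proof -
  have "word_cong R `` {u' @ v'} = word_cong R `` {u @ v}"
    if "(u, u') \<in> word_cong R" "(v, v') \<in> word_cong R" for u' v'
    using equiv_class_eq[OF equiv_word_cong word_cong.append[OF that]] by simp
  then show ?thesis
    by (auto simp: presented_group_def intro: word_cong.refl)
qed

lemma carrier_presented_group:
  "X \<in> carrier (presented_group R) \<longleftrightarrow> (\<exists>u. X = word_cong R `` {u})"
  by (auto simp: presented_group_def quotient_def)

lemma one_presented_group: "\<one>\<^bsub>presented_group R\<^esub> = word_cong R `` {[]}"
  by (simp add: presented_group_def)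

lemma word_cong_inverse: "(rev (map flip w) @ w, []) \<in> word_cong R"
proof (induction w)
  case Nil
  show ?case by (simp add: word_cong.refl)
next
  case (Cons x w)
  have "([flip x, flip (flip x)], []) \<in> word_cong R"
    by (rule word_cong.cancel)
  moreover have "flip (flip x) = x"
    by (cases x) auto
  ultimately have "([flip x, x], []) \<in> word_cong R"
    by simp
  then have "(rev (map flip w) @ [flip x, x] @ w, rev (map flip w) @ [] @ w) \<in> word_cong R"
    by (intro word_cong.append word_cong.refl)
  with Cons show ?case
    by (auto intro: word_cong.trans)
qed

lemma group_presented_group: "group (presented_group R)"
proof (rule groupI)
  fix X assume "X \<in> carrier (presented_group R)"
  then obtain u where X: "X = word_cong R `` {u}"
    by (auto simp: carrier_presented_group)
  have "word_cong R `` {rev (map flip u) @ u} = word_cong R `` {[]}"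
    by (rule equiv_class_eq[OF equiv_word_cong word_cong_inverse])
  then show "\<exists>Y\<in>carrier (presented_group R). Y \<otimes>\<^bsub>presented_group R\<^esub> X = \<one>\<^bsub>presented_group R\<^esub>"
    unfolding X one_presented_group
    by (intro bexI[of _ "word_cong R `` {rev (map flip u)}"])
       (auto simp: mult_presented_group carrier_presented_group)
qed (auto simp: carrier_presented_group mult_presented_group one_presented_group)

datatype quat_gen = a | b

text \<open>The relations \<open>a\<^sup>2\<^sup>n = e = b\<^sup>4\<close>, \<open>a\<^sup>n = b\<^sup>2\<close>, \<open>b a b\<inverse> = a\<inverse>\<close>.\<close>

definition quaternion_group :: "nat \<Rightarrow> quat_gen letter list set monoid" where
  "quaternion_group n = presented_group
    {(replicate (2 * n) (Gen a), []),
     ([], replicate 4 (Gen b)),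
     (replicate n (Gen a), replicate 2 (Gen b)),
     ([Gen b, Gen a, Inv b], [Inv a])}"

hide_const (open) a b

section \<open>Graph parameters\<close>

text \<open>As in \<^theory>\<open>Graph_Theory.Graph_Theory\<close>, an undirected simple graph is a symmetric
  loop-free digraph without parallel arcs (locale \<^locale>\<open>graph\<close>).\<close>

text \<open>Meant for finite graphs. The graph without vertices is not
  \<^const>\<open>Digraph_Component.connected\<close>; this has no influence on the minimum, as leaving a single
  vertex already suffices.\<close>

definition connectivity :: "('v, 'e) pre_digraph \<Rightarrow> nat" where
  "connectivity G = (LEAST k. \<exists>S \<subseteq> verts G. finite S \<and> card S = k \<and>
     (\<not> Digraph_Component.connected (G \<restriction> (verts G - S)) \<or> card (verts G - S) = 1))"

definition independent_set :: "('v, 'e) pre_digraph \<Rightarrow> 'v set \<Rightarrow> bool" where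
  "independent_set G S \<longleftrightarrow> S \<subseteq> verts G \<and> (\<forall>u\<in>S. \<forall>v\<in>S. (u, v) \<notin> arcs_ends G)"

definition independence_number :: "('v, 'e) pre_digraph \<Rightarrow> nat" where
  "independence_number G = Max {card S | S. independent_set G S}"

text \<open>The length is bounded because \<^const>\<open>pre_digraph.cycle\<close> admits traversing an edge
  back and forth.\<close>

definition hamiltonian :: "('v, 'e) pre_digraph \<Rightarrow> bool" where
  "hamiltonian G \<longleftrightarrow>
     (\<exists>p. pre_digraph.cycle G p \<and> 3 \<le> length p \<and> tail G ` set p = verts G)"

section \<open>Reduced power graphs\<close>

definition reduced_power_graph :: "('a, 'm) monoid_scheme \<Rightarrow> ('a, 'a \<times> 'a) pre_digraph" where
  "reduced_power_graph G = with_proj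
    \<lparr>pverts = carrier G,
     parcs = {(u, v). u \<in> carrier G \<and> v \<in> carrier G \<and>
       (generate G {v} \<subset> generate G {u} \<or> generate G {u} \<subset> generate G {v})}\<rparr>"

definition proper_reduced_power_graph ::
    "('a, 'm) monoid_scheme \<Rightarrow> ('a, 'a \<times> 'a) pre_digraph" where
  "proper_reduced_power_graph G = reduced_power_graph G \<restriction> (carrier G - {\<one>\<^bsub>G\<^esub>})"

lemma graph_reduced_power_graph:
  assumes "finite (carrier G)"
  shows "graph (reduced_power_graph G)"
proof -
  let ?H = "\<lparr>pverts = carrier G,
     parcs = {(u, v). u \<in> carrier G \<and> v \<in> carrier G \<and>
       (generate G {v} \<subset> generate G {u} \<or> generate G {u} \<subset> generate G {v})}\<rparr>"
  have "finite (parcs ?H)"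
    by (rule finite_subset[of _ "carrier G \<times> carrier G"]) (use assms in auto)
  then have "pair_graph ?H"
    using assms by unfold_locales (auto simp: symmetric_def sym_def)
  then interpret pair_graph ?H .
  show ?thesis
    unfolding reduced_power_graph_def by (rule graph_axioms)
qed

end

theory Submission
  imports Defs "HOL-Algebra.Multiplicative_Group"
begin

text \<open>Everything rests on the shape of the cyclic subgroups of \<open>Q\<^bsub>4n\<^esub>\<close>. Let \<open>H = \<langle>a\<rangle>\<close>, cyclic of
  order \<open>2n\<close>, and \<open>z = a\<^sup>n = b\<^sup>2\<close>. Each of the \<open>2n\<close> elements \<open>u\<close> outside \<open>H\<close> satisfies \<open>u\<^sup>2 = z\<close>, so
  \<open>\<langle>u\<rangle> = {e, z, u, uz}\<close>, and \<open>u\<close> is adjacent to \<open>e\<close> and \<open>z\<close> only (lemmas \<open>generate_outside_H\<close> and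
  \<open>dominates_outside_H\<close>).

  Connectivity: the identity is adjacent to every other vertex, and after its removal every
  vertex still reaches \<open>z\<close>, if necessary by way of \<open>a\<close>; removing \<open>e\<close> and \<open>z\<close> isolates the
  elements outside \<open>H\<close>. Independence number: the elements outside \<open>H\<close> can be added to any
  independent subset of \<open>H\<close> that avoids \<open>e\<close> and \<open>z\<close>, and as these two are adjacent, avoiding
  them costs at most one element; moreover \<open>H\<close> is a copy of \<open>\<int>\<^bsub>2n\<^esub>\<close>. Hamiltonicity: on a spanning
  cycle the \<open>2n \<ge> 4\<close> elements outside \<open>H\<close> would have distinct successors, all of them in
  \<open>{e, z}\<close>.

  These arguments are carried out in the locale \<open>generalized_quaternion\<close>. That the presented
  group belongs to it, that is, that the relations do not force a further collapse, is seen
  from the action of words on normal forms (lemma \<open>word_cong_imp_quat_act_eq\<close>).\<close>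

section \<open>Connectivity, independence and Hamiltonicity of finite graphs\<close>

lemma (in sym_digraph) connected_if_all_reach:
  assumes "h \<in> verts G" and "\<And>v. v \<in> verts G \<Longrightarrow> v \<rightarrow>\<^sup>* h"
  shows "connected G"
proof (rule connectedI)
  show "verts G \<noteq> {}" using assms(1) by auto
  fix u v assume "u \<in> verts G" "v \<in> verts G"
  then have "u \<rightarrow>\<^sup>* h" "h \<rightarrow>\<^sup>* v"
    using assms(2) symmetric_reachable' by blast+
  then show "u \<rightarrow>\<^sup>*\<^bsub>mk_symmetric G\<^esub> v"
    unfolding reachable_mk_symmetric_eq[OF sym_arcs] by (rule reachable_trans)
qed

lemma (in sym_digraph) not_connected_if_isolated:
  assumes "v \<in> verts G" "w \<in> verts G" "v \<noteq> w" and "\<And>u. \<not> v \<rightarrow> u"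
  shows "\<not> connected G"
proof
  assume "connected G"
  then have "v \<rightarrow>\<^sup>*\<^bsub>mk_symmetric G\<^esub> w"
    using assms by (auto simp: connected_def strongly_connected_def)
  then have "v \<rightarrow>\<^sup>* w"
    by (simp only: reachable_mk_symmetric_eq[OF sym_arcs])
  then show False
    using assms by (cases rule: converse_reachable_cases) auto
qed

lemma connectivity_eqI:
  assumes "S \<subseteq> verts G" "finite S" "card S = k"
    and "\<not> Digraph_Component.connected (G \<restriction> (verts G - S))"
    and "\<And>T. T \<subseteq> verts G \<Longrightarrow> finite T \<Longrightarrow> card T < k \<Longrightarrow>
      Digraph_Component.connected (G \<restriction> (verts G - T)) \<and> card (verts G - T) \<noteq> 1"
  shows "connectivity G = k"
  unfolding connectivity_def
proof (rule Least_equality)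
  fix m
  assume "\<exists>S\<subseteq>verts G. finite S \<and> card S = m \<and>
     (\<not> Digraph_Component.connected (G \<restriction> (verts G - S)) \<or> card (verts G - S) = 1)"
  then show "k \<le> m"
    using assms(5) by (metis not_le)
qed (use assms in blast)

lemma induce_subgraph_induce_subgraph:
  "V \<subseteq> U \<Longrightarrow> (G \<restriction> U) \<restriction> V = G \<restriction> V"
  by (auto simp: induce_subgraph_def)

lemma finite_card_independent_sets:
  assumes "finite (verts G)"
  shows "finite {card S | S. independent_set G S}"
  by (rule finite_subset[of _ "card ` Pow (verts G)"])
     (use assms in \<open>auto simp: independent_set_def\<close>)

lemma card_le_independence_number:
  assumes "finite (verts G)" "independent_set G S"
  shows "card S \<le> independence_number G"
  unfolding independence_number_def
  by (rule Max_ge[OF finite_card_independent_sets[OF assms(1)]]) (use assms in auto)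

lemma independence_number_attained:
  assumes "finite (verts G)"
  obtains S where "independent_set G S" "card S = independence_number G"
proof -
  have "independent_set G {}"
    by (simp add: independent_set_def)
  then have "{card S | S. independent_set G S} \<noteq> {}"
    by blast
  from Max_in[OF finite_card_independent_sets[OF assms] this] show ?thesis
    using that by (auto simp: independence_number_def)
qed

text \<open>Along a spanning cycle the successor map is injective, so the vertices of \<open>D\<close> have
  as many distinct successors.\<close>

lemma hamiltonian_card_le:
  assumes "hamiltonian G" "D \<subseteq> verts G" "finite N"
    and "\<And>e. e \<in> arcs G \<Longrightarrow> tail G e \<in> D \<Longrightarrow> head G e \<in> N"
  shows "card D \<le> card N"
proof -
  obtain p u where p: "pre_digraph.awalk G u p u" "p \<noteq> []"
      "distinct (tl (pre_digraph.awalk_verts G u p))" "tail G ` set p = verts G"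
    using assms(1) by (auto simp: hamiltonian_def pre_digraph.cycle_def)
  then have arcs: "set p \<subseteq> arcs G" and "pre_digraph.cas G u p u"
    by (auto simp: pre_digraph.awalk_def)
  with p have "distinct (map (head G) p)"
    by (simp add: pre_digraph.awalk_verts_conv')
  then have inj: "inj_on (head G) (set p)"
    by (simp add: distinct_map)
  define E where "E = {e \<in> set p. tail G e \<in> D}"
  have "finite E" "E \<subseteq> set p"
    by (auto simp: E_def)
  have "D \<subseteq> tail G ` E"
    using p(4) assms(2) by (auto simp: E_def)
  then have "card D \<le> card E"
    using \<open>finite E\<close> by (rule surj_card_le[rotated])
  also have "\<dots> = card (head G ` E)"
    by (rule card_image[symmetric]) (rule inj_on_subset[OF inj \<open>E \<subseteq> set p\<close>])
  also have "\<dots> \<le> card N"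
    by (rule card_mono[OF assms(3)]) (use assms(4) arcs in \<open>auto simp: E_def\<close>)
  finally show ?thesis .
qed


section \<open>Reduced power graphs\<close>

lemma verts_reduced_power_graph [simp]: "verts (reduced_power_graph G) = carrier G"
  by (simp add: reduced_power_graph_def)

lemma arcs_ends_reduced_power_graph:
  "(u, v) \<in> arcs_ends (reduced_power_graph G) \<longleftrightarrow> u \<in> carrier G \<and> v \<in> carrier G \<and>
     (generate G {v} \<subset> generate G {u} \<or> generate G {u} \<subset> generate G {v})"
  by (simp add: reduced_power_graph_def)

lemma arcs_ends_induced_reduced_power_graph:
  "(u, v) \<in> arcs_ends (reduced_power_graph G \<restriction> U) \<longleftrightarrow>
     u \<in> U \<and> v \<in> U \<and> (u, v) \<in> arcs_ends (reduced_power_graph G)"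
  by (auto simp: arcs_ends_conv reduced_power_graph_def)

lemma sym_digraph_induced_reduced_power_graph:
  "sym_digraph (reduced_power_graph G \<restriction> U)"
proof
  show "symmetric (reduced_power_graph G \<restriction> U)"
    unfolding symmetric_def
    by (rule symI) (auto simp: arcs_ends_induced_reduced_power_graph arcs_ends_reduced_power_graph)
qed (auto simp: reduced_power_graph_def)

lemma hamiltonian_reduced_power_graph_card_le:
  assumes "hamiltonian (reduced_power_graph G \<restriction> U)" "D \<subseteq> U" "finite N"
    and "\<And>u v. u \<in> D \<Longrightarrow> v \<in> U \<Longrightarrow> (u, v) \<in> arcs_ends (reduced_power_graph G) \<Longrightarrow> v \<in> N"
  shows "card D \<le> card N"
proof (rule hamiltonian_card_le[OF assms(1) _ assms(3)])
  fix e assume "e \<in> arcs (reduced_power_graph G \<restriction> U)" "tail (reduced_power_graph G \<restriction> U) e \<in> D"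
  then show "head (reduced_power_graph G \<restriction> U) e \<in> N"
    using assms(4)[of "fst e" "snd e"] by (auto simp: reduced_power_graph_def)
qed (use assms in auto)

lemma reduced_power_graph_induced_carrier:
  "reduced_power_graph G \<restriction> carrier G = reduced_power_graph G"
  by (auto simp: reduced_power_graph_def induce_subgraph_def with_proj_def)

text \<open>An injective homomorphism preserves and reflects proper inclusion of cyclic subgroups.\<close>

lemma (in group_hom) independent_set_reduced_power_graph_image:
  assumes inj: "inj_on h (carrier G)" and T: "T \<subseteq> carrier G"
  shows "independent_set (reduced_power_graph H) (h ` T) \<longleftrightarrow>
    independent_set (reduced_power_graph G) T"
proof -
  have img: "generate H {h t} = h ` generate G {t}" if "t \<in> carrier G" for t
    using generate_img[of "{t}"] that by simp
  have psubset: "generate H {h s} \<subset> generate H {h t} \<longleftrightarrow> generate G {s} \<subset> generate G {t}"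
    if "s \<in> carrier G" "t \<in> carrier G" for s t
  proof -
    have sub: "generate G {s} \<subseteq> carrier G" "generate G {t} \<subseteq> carrier G"
      using that G.generate_incl by auto
    have "h g \<in> h ` generate G {t} \<longleftrightarrow> g \<in> generate G {t}" if "g \<in> generate G {s}" for g
      using that sub(1) by (intro inj_on_image_mem_iff[OF inj _ sub(2)]) auto
    then have "h ` generate G {s} \<subseteq> h ` generate G {t} \<longleftrightarrow> generate G {s} \<subseteq> generate G {t}"
      unfolding image_subset_iff by blast
    then show ?thesis
      using that inj_on_image_eq_iff[OF inj sub] by (simp add: img psubset_eq)
  qed
  have "(h s, h t) \<in> arcs_ends (reduced_power_graph H) \<longleftrightarrow>
      (s, t) \<in> arcs_ends (reduced_power_graph G)" if "s \<in> T" "t \<in> T" for s t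
    using that T psubset[of s t] psubset[of t s]
    by (simp add: arcs_ends_reduced_power_graph subset_iff)
  then show ?thesis
    using T by (auto simp: independent_set_def)
qed

context group
begin

lemma reduced_power_graph_dominates_one:
  assumes "u \<in> carrier G" "u \<noteq> \<one>"
  shows "(u, \<one>) \<in> arcs_ends (reduced_power_graph G)"
proof -
  have "\<one> \<in> generate G {u}" "u \<in> generate G {u}"
    by (auto intro: generate.one generate.incl)
  then show ?thesis
    using assms by (auto simp: arcs_ends_reduced_power_graph generate_one)
qed

lemma hom_int_pow_integer_mod_group:
  assumes "x \<in> carrier G"
  shows "(\<lambda>k. x [^] k) \<in> hom (integer_mod_group (ord x)) G"
proof (rule homI)
  fix k l :: int
  have "x [^] ((k + l) mod int (ord x)) = x [^] (k + l)"
    using assms by (subst int_pow_eq) auto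
  then show "x [^] (k \<otimes>\<^bsub>integer_mod_group (ord x)\<^esub> l) = x [^] k \<otimes> x [^] l"
    using assms by (simp add: int_pow_mult)
qed (use assms in auto)

lemma bij_betw_int_pow_integer_mod_group:
  assumes "x \<in> carrier G" "ord x \<noteq> 0"
  shows "bij_betw (\<lambda>k. x [^] k) (carrier (integer_mod_group (ord x))) (generate G {x})"
proof (rule bij_betw_imageI)
  show "inj_on (\<lambda>k. x [^] k) (carrier (integer_mod_group (ord x)))"
    using assms
    by (intro inj_onI) (auto simp: carrier_integer_mod_group int_pow_eq mod_eq_dvd_iff[symmetric])
  show "(\<lambda>k. x [^] k) ` carrier (integer_mod_group (ord x)) = generate G {x}"
  proof (intro equalityI subsetI)
    fix g assume "g \<in> generate G {x}"
    then obtain k :: int where "g = x [^] k"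
      by (auto simp: generate_pow[OF assms(1)])
    moreover have "x [^] k = x [^] (k mod int (ord x))"
      using assms by (subst int_pow_eq) (auto simp: mod_eq_dvd_iff[symmetric])
    ultimately show "g \<in> (\<lambda>k. x [^] k) ` carrier (integer_mod_group (ord x))"
      using assms by (auto simp: carrier_integer_mod_group)
  qed (auto simp: generate_pow[OF assms(1)])
qed

text \<open>As \<open>\<langle>x\<rangle>\<close> is isomorphic to \<open>\<int>\<^sub>m\<close>, \<open>m\<close> the order of \<open>x\<close>, the independence number of the
  latter is the largest size of an independent set inside \<open>\<langle>x\<rangle>\<close>.\<close>

lemma
  assumes x: "x \<in> carrier G" "ord x \<noteq> 0"
  shows card_le_independence_number_cyclic:
      "independent_set (reduced_power_graph G) S \<Longrightarrow> S \<subseteq> generate G {x} \<Longrightarrow>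
        card S \<le> independence_number (reduced_power_graph (integer_mod_group (ord x)))"
    and independence_number_cyclic_attained:
      "\<exists>S. independent_set (reduced_power_graph G) S \<and> S \<subseteq> generate G {x} \<and>
        card S = independence_number (reduced_power_graph (integer_mod_group (ord x)))"
proof -
  let ?Z = "integer_mod_group (ord x)"
  let ?f = "\<lambda>k::int. x [^] k"
  interpret Z: group_hom ?Z G ?f
    by (intro group_hom.intro group_hom_axioms.intro)
       (use hom_int_pow_integer_mod_group[OF x(1)] in \<open>auto intro: group_axioms\<close>)
  have inj: "inj_on ?f (carrier ?Z)" and im: "?f ` carrier ?Z = generate G {x}"
    using bij_betw_int_pow_integer_mod_group[OF x] by (auto simp: bij_betw_def)
  have fin: "finite (verts (reduced_power_graph ?Z))"
    using x by (simp add: carrier_integer_mod_group)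
  have card: "card (?f ` T) = card T" if "T \<subseteq> carrier ?Z" for T
    by (rule card_image) (rule inj_on_subset[OF inj that])
  show "card S \<le> independence_number (reduced_power_graph ?Z)"
    if S: "independent_set (reduced_power_graph G) S" "S \<subseteq> generate G {x}"
  proof -
    obtain T where "T \<subseteq> carrier ?Z" "S = ?f ` T"
      using S(2) unfolding im[symmetric] by (auto simp: subset_image_iff)
    with S(1) show ?thesis
      using card_le_independence_number[OF fin] card
      by (simp add: Z.independent_set_reduced_power_graph_image[OF inj])
  qed
  obtain T where T: "independent_set (reduced_power_graph ?Z) T"
      "card T = independence_number (reduced_power_graph ?Z)"
    using independence_number_attained[OF fin] .
  then have "T \<subseteq> carrier ?Z"
    by (simp add: independent_set_def)
  then show "\<exists>S. independent_set (reduced_power_graph G) S \<and> S \<subseteq> generate G {x} \<and>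
      card S = independence_number (reduced_power_graph ?Z)"
    using T card im
    by (intro exI[of _ "?f ` T"])
       (auto simp: Z.independent_set_reduced_power_graph_image[OF inj])
qed

end


section \<open>Generalized quaternion groups\<close>

text \<open>A group generated by \<open>x\<close> and \<open>y\<close> subject to the defining relations of \<open>Q\<^bsub>4n\<^esub>\<close>. That \<open>x\<close> has
  order exactly \<open>2n\<close> and that \<open>y\<close> is not a power of \<open>x\<close> excludes proper quotients, so that the
  group has order \<open>4n\<close>.\<close>

locale generalized_quaternion = group G for G (structure) +
  fixes n :: nat and x y
  assumes n: "2 \<le> n"
    and x: "x \<in> carrier G" and y: "y \<in> carrier G"
    and ord_x: "ord x = 2 * n"
    and pow_x_n: "x [^] n = y \<otimes> y"
    and y_mult_x: "y \<otimes> x = inv x \<otimes> y"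
    and y_not_in: "y \<notin> generate G {x}"
    and carrier_generated: "carrier G = generate G {x, y}"
begin

text \<open>The cyclic subgroup of index two, and the central involution \<open>x\<^sup>n = y\<^sup>2\<close>.\<close>

definition H where "H = generate G {x}"
definition z where "z = x [^] n"

lemma H_eq: "H = {x [^] k | k. k \<in> (UNIV :: nat set)}"
  unfolding H_def by (rule generate_pow_nat[OF x]) (use n ord_x in simp)

sublocale H: subgroup H G
  unfolding H_def by (rule generate_is_subgroup) (use x in simp)

lemma H_comm: "g \<in> H \<Longrightarrow> h \<in> H \<Longrightarrow> g \<otimes> h = h \<otimes> g"
  using x by (auto simp: H_eq nat_pow_comm)

lemma card_H: "card H = 2 * n"
  unfolding H_def using generate_pow_card[OF x] ord_x by simp

lemma y_mult_H:
  assumes "h \<in> H" shows "y \<otimes> h = inv h \<otimes> y"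
proof -
  have "y \<otimes> x [^] k = inv (x [^] k) \<otimes> y" for k :: nat
  proof (induction k)
    case (Suc k)
    have "y \<otimes> x [^] Suc k = (y \<otimes> x [^] k) \<otimes> x"
      using x y by (simp add: m_assoc)
    also have "\<dots> = inv (x [^] k) \<otimes> (inv x \<otimes> y)"
      using x y by (simp add: Suc m_assoc y_mult_x)
    also have "\<dots> = inv (x [^] Suc k) \<otimes> y"
      using x y nat_pow_Suc2[OF x, of k] by (simp add: m_assoc inv_mult_group del: nat_pow_Suc)
    finally show ?case .
  qed (use y in simp)
  then show ?thesis using assms by (auto simp: H_eq)
qed

lemma z_in_H: "z \<in> H"
  by (auto simp: z_def H_eq)

lemma z_carrier [simp]: "z \<in> carrier G"
  using z_in_H by simp

lemma z_eq: "z = y \<otimes> y"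
  by (simp add: z_def pow_x_n)

lemma z_not_one: "z \<noteq> \<one>"
proof
  assume "z = \<one>"
  then have "2 * n dvd n"
    using pow_eq_id[OF x] ord_x by (simp add: z_def)
  then show False using n by (auto dest: dvd_imp_le)
qed

lemma z_mult_z: "z \<otimes> z = \<one>"
  unfolding z_def using x n ord_x by (simp add: nat_pow_mult pow_eq_id mult_2[symmetric])

lemma y_notin_H: "y \<notin> H"
  using y_not_in by (simp add: H_def)

lemma Hy_mult_Hy:
  assumes "g \<in> H" "h \<in> H"
  shows "(g \<otimes> y) \<otimes> (h \<otimes> y) = g \<otimes> inv h \<otimes> z"
proof -
  have "(g \<otimes> y) \<otimes> (h \<otimes> y) = g \<otimes> (y \<otimes> h) \<otimes> y"
    using assms y by (simp add: m_assoc)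
  also have "\<dots> = g \<otimes> inv h \<otimes> z"
    using assms y by (simp add: y_mult_H z_eq m_assoc)
  finally show ?thesis .
qed

lemma Hy_mult_H:
  assumes "g \<in> H" "h \<in> H"
  shows "(g \<otimes> y) \<otimes> h = g \<otimes> inv h \<otimes> y"
  using assms y by (simp add: m_assoc y_mult_H)

text \<open>The union of \<open>H\<close> and \<open>Hy\<close> is closed under the operations and contains both generators.\<close>

lemma carrier_eq: "carrier G = H \<union> (\<lambda>h. h \<otimes> y) ` H"
proof
  let ?K = "H \<union> (\<lambda>h. h \<otimes> y) ` H"
  have "subgroup ?K G"
  proof
    show "?K \<subseteq> carrier G" using y by auto
    show "g \<otimes> h \<in> ?K" if "g \<in> ?K" "h \<in> ?K" for g h
    proof -
      have "g \<otimes> (h \<otimes> y) = (g \<otimes> h) \<otimes> y" if "g \<in> H" "h \<in> H" for g h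
        using that y by (simp add: m_assoc)
      then show ?thesis
        using that z_in_H by (auto simp: Hy_mult_Hy Hy_mult_H)
    qed
    show "inv g \<in> ?K" if "g \<in> ?K" for g
      using that
    proof
      assume "g \<in> (\<lambda>h. h \<otimes> y) ` H"
      then obtain h where h: "h \<in> H" "g = h \<otimes> y" by auto
      have "g \<otimes> ((h \<otimes> z) \<otimes> y) = h \<otimes> inv (h \<otimes> z) \<otimes> z"
        using h z_in_H by (simp add: Hy_mult_Hy)
      also have "\<dots> = \<one>"
        using h z_in_H by (simp add: H_comm[of h z] inv_mult_group m_assoc[symmetric])
      finally have "((h \<otimes> z) \<otimes> y) \<otimes> g = \<one>"
        by (rule inv_comm) (use h y in simp_all)
      then have "inv g = (h \<otimes> z) \<otimes> y"
        by (rule inv_equality) (use h y in simp_all)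
      then show ?thesis using h z_in_H by auto
    qed auto
  qed auto
  moreover have "{x, y} \<subseteq> ?K"
  proof -
    have "x \<in> H" unfolding H_def by (rule generate.incl) simp
    moreover have "y \<in> (\<lambda>h. h \<otimes> y) ` H"
      using y by (intro image_eqI[of _ _ \<one>]) auto
    ultimately show ?thesis by auto
  qed
  ultimately show "carrier G \<subseteq> ?K"
    unfolding carrier_generated by (intro generate_subgroup_incl)
  show "?K \<subseteq> carrier G" using y by auto
qed

lemma carrier_minus_H: "carrier G - H = (\<lambda>h. h \<otimes> y) ` H"
proof -
  have "h \<otimes> y \<notin> H" if "h \<in> H" for h
  proof
    assume "h \<otimes> y \<in> H"
    then have "inv h \<otimes> (h \<otimes> y) \<in> H" using that by blast
    then show False using that y y_notin_H by (simp add: m_assoc[symmetric])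
  qed
  then show ?thesis unfolding carrier_eq by auto
qed

lemma finite_H: "finite H"
  using card_H n by (auto intro: card_ge_0_finite)

lemma finite_carrier: "finite (carrier G)"
  unfolding carrier_eq using finite_H by simp

lemma card_carrier_minus_H: "card (carrier G - H) = 2 * n"
proof -
  have "inj_on (\<lambda>h. h \<otimes> y) H"
    using y by (auto intro!: inj_onI)
  then show ?thesis
    by (simp add: carrier_minus_H card_image card_H)
qed

lemma card_carrier: "card (carrier G) = 4 * n"
  using card_Diff_subset[OF finite_H H.subset] card_carrier_minus_H card_H
    card_mono[OF finite_carrier H.subset] by simp

lemma square_outside_H:
  assumes "u \<in> carrier G - H" shows "u \<otimes> u = z"
  using assms z_in_H y by (auto simp: carrier_minus_H Hy_mult_Hy)

lemma generate_z: "generate G {z} = {\<one>, z}"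
proof -
  have "subgroup {\<one>, z} G"
    using z_mult_z inv_equality[OF z_mult_z] by unfold_locales auto
  then show ?thesis
    using generate_subgroup_incl[of "{z}" "{\<one>, z}"] by (auto intro: generate.one generate.incl)
qed

text \<open>Every element outside \<open>H\<close> has order four, and its cyclic subgroup meets \<open>H\<close> in \<open>{\<one>, z}\<close>.\<close>

lemma generate_outside_H:
  assumes "u \<in> carrier G - H" shows "generate G {u} = {\<one>, z, u, u \<otimes> z}"
proof
  have uc: "u \<in> carrier G" and uu: "u \<otimes> u = z"
    using assms square_outside_H by auto
  have uz: "z \<otimes> u = u \<otimes> z"
    using uc by (simp add: uu[symmetric] m_assoc)
  have uuz: "u \<otimes> (u \<otimes> z) = \<one>"
    using uc by (simp add: m_assoc[symmetric] uu z_mult_z)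
  have uzu: "u \<otimes> z \<otimes> u = \<one>"
    using uc by (simp add: m_assoc uz uuz)
  have uzz: "u \<otimes> z \<otimes> z = u"
    using uc by (simp add: m_assoc z_mult_z)
  have zuz: "z \<otimes> (u \<otimes> z) = u"
    using uc by (simp add: m_assoc[symmetric] uz uzz)
  have uzuz: "u \<otimes> z \<otimes> (u \<otimes> z) = z"
    using uc by (simp add: m_assoc zuz uu)
  have "inv z = z" "inv u = u \<otimes> z" "inv (u \<otimes> z) = u"
    using uc z_mult_z uzu uuz by (auto intro: inv_equality)
  then have "subgroup {\<one>, z, u, u \<otimes> z} G"
    using uc uu uz uuz uzu uzz zuz uzuz z_mult_z by unfold_locales auto
  then show "generate G {u} \<subseteq> {\<one>, z, u, u \<otimes> z}"
    by (intro generate_subgroup_incl) auto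
  have u: "u \<in> generate G {u}"
    by (auto intro: generate.incl)
  moreover have z: "z \<in> generate G {u}"
    using generate.eng[OF u u] by (simp add: uu)
  ultimately show "{\<one>, z, u, u \<otimes> z} \<subseteq> generate G {u}"
    using generate.eng[OF u z] by (auto intro: generate.one)
qed

lemma u_mult_z_outside_H:
  assumes "u \<in> carrier G - H" shows "u \<otimes> z \<in> carrier G - H"
proof -
  have "u \<otimes> z \<notin> H"
  proof
    assume "u \<otimes> z \<in> H"
    then have "u \<otimes> z \<otimes> z \<in> H" using z_in_H by blast
    then show False using assms by (simp add: m_assoc z_mult_z)
  qed
  then show ?thesis using assms by auto
qed

lemma dominates_outside_H:
  assumes u: "u \<in> carrier G - H" and "(u, v) \<in> arcs_ends (reduced_power_graph G)"
  shows "v \<in> {\<one>, z}"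
proof (rule ccontr)
  assume v: "v \<notin> {\<one>, z}"
  \<comment> \<open>If \<open>v\<close> lay in \<open>H\<close>, neither inclusion would be possible; outside \<open>H\<close> a proper inclusion fails
    because \<open>u\<close> and \<open>uz\<close> generate the same subgroup.\<close>
  have vc: "v \<in> carrier G"
    and sub: "generate G {v} \<subset> generate G {u} \<or> generate G {u} \<subset> generate G {v}"
    using assms(2) by (auto simp: arcs_ends_reduced_power_graph)
  have "u \<in> generate G {u}" "v \<in> generate G {v}"
    by (auto intro: generate.incl)
  moreover have "generate G {v} \<subseteq> H" if "v \<in> H"
    by (rule generate_subgroup_incl) (use that H.subgroup_axioms in auto)
  moreover have "\<not> generate G {v} \<subset> generate G {u}" if "v \<in> H"
    using that v u u_mult_z_outside_H[OF u] \<open>v \<in> generate G {v}\<close> generate_outside_H[OF u] by auto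
  ultimately have vH: "v \<in> carrier G - H"
    using sub u vc by auto
  have uz: "u \<otimes> z \<otimes> z = u" and vz: "v \<otimes> z \<otimes> z = v"
    using u vc by (simp_all add: m_assoc z_mult_z)
  have "u \<notin> {\<one>, z}"
    using u z_in_H by auto
  moreover have "v \<in> generate G {u} \<or> u \<in> generate G {v}"
    using sub \<open>u \<in> generate G {u}\<close> \<open>v \<in> generate G {v}\<close> by blast
  ultimately consider "v = u" | "v = u \<otimes> z" | "u = v \<otimes> z"
    using v unfolding generate_outside_H[OF u] generate_outside_H[OF vH] by blast
  then have "generate G {v} = generate G {u}"
    unfolding generate_outside_H[OF u] generate_outside_H[OF vH]
    by cases (auto simp: uz vz)
  then show False
    using sub by simp
qed

lemma outside_H_dominates_z:
  assumes u: "u \<in> carrier G - H"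
  shows "(u, z) \<in> arcs_ends (reduced_power_graph G)"
proof -
  have "u \<noteq> \<one>" "u \<noteq> z"
    using u z_in_H by auto
  then show ?thesis
    using u by (auto simp: arcs_ends_reduced_power_graph generate_z generate_outside_H)
qed

lemma connected_with_one:
  assumes "\<one> \<in> U" "U \<subseteq> carrier G"
  shows "Digraph_Component.connected (reduced_power_graph G \<restriction> U)"
proof -
  interpret sym_digraph "reduced_power_graph G \<restriction> U"
    by (rule sym_digraph_induced_reduced_power_graph)
  have "reachable (reduced_power_graph G \<restriction> U) v \<one>" if "v \<in> U" for v
    using that assms reduced_power_graph_dominates_one[of v]
    by (cases "v = \<one>") (auto simp: arcs_ends_induced_reduced_power_graph intro!: reachable_adjI)
  then show ?thesis
    using assms by (intro connected_if_all_reach[of \<one>]) auto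
qed

text \<open>Without the identity, every vertex still reaches \<open>z\<close> directly or by way of \<open>x\<close>.\<close>

lemma connected_without_one:
  "Digraph_Component.connected (reduced_power_graph G \<restriction> (carrier G - {\<one>}))"
proof -
  let ?G = "reduced_power_graph G \<restriction> (carrier G - {\<one>})"
  interpret sym_digraph ?G
    by (rule sym_digraph_induced_reduced_power_graph)
  have "card {\<one>, z} < card H"
    using n by (simp add: card_H z_not_one[symmetric])
  then have zH: "generate G {z} \<subset> H"
    using z_in_H by (auto simp: generate_z)
  have "x \<noteq> \<one>"
    using ord_x n by (auto simp: ord_eq_1[symmetric])
  have xz: "(x, z) \<in> arcs_ends ?G"
    using zH x \<open>x \<noteq> \<one>\<close> z_not_one
    by (auto simp: arcs_ends_induced_reduced_power_graph arcs_ends_reduced_power_graph H_def)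
  have "reachable ?G v z" if v: "v \<in> carrier G - {\<one>}" for v
  proof -
    consider "v \<notin> H" | "v \<in> H" "generate G {v} = H" | "v \<in> H" "generate G {v} \<noteq> H"
      by blast
    then show ?thesis
    proof cases
      case 1
      then show ?thesis
        using v outside_H_dominates_z[of v] z_not_one
        by (auto simp: arcs_ends_induced_reduced_power_graph intro!: reachable_adjI)
    next
      case 2
      then show ?thesis
        using v zH z_not_one
        by (auto simp: arcs_ends_induced_reduced_power_graph arcs_ends_reduced_power_graph
            intro!: reachable_adjI)
    next
      case 3
      then have "generate G {v} \<subset> H"
        using generate_subgroup_incl[of "{v}" H] H.subgroup_axioms by auto
      then have "(v, x) \<in> arcs_ends ?G"
        using v x \<open>x \<noteq> \<one>\<close>
        by (auto simp: arcs_ends_induced_reduced_power_graph arcs_ends_reduced_power_graph H_def)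
      then show ?thesis
        using xz by (auto intro: adj_reachable_trans)
    qed
  qed
  then show ?thesis
    using z_not_one by (intro connected_if_all_reach[of z]) auto
qed

lemma not_connected_without_one_and_z:
  "\<not> Digraph_Component.connected (reduced_power_graph G \<restriction> (carrier G - {\<one>, z}))"
proof -
  interpret sym_digraph "reduced_power_graph G \<restriction> (carrier G - {\<one>, z})"
    by (rule sym_digraph_induced_reduced_power_graph)
  have "\<one> \<otimes> y \<in> carrier G - H"
    unfolding carrier_minus_H by (rule imageI) simp
  then have yH: "y \<in> carrier G - H"
    using y by simp
  have "y \<otimes> z \<noteq> y"
    using y z_not_one by simp
  moreover have "u \<in> carrier G - {\<one>, z}" if "u \<in> carrier G - H" for u
    using that z_in_H by auto
  ultimately show ?thesis
    using yH u_mult_z_outside_H[OF yH] dominates_outside_H[OF yH]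
    by (intro not_connected_if_isolated[of y "y \<otimes> z"])
       (auto simp: arcs_ends_induced_reduced_power_graph)
qed

lemma verts_proper: "verts (proper_reduced_power_graph G) = carrier G - {\<one>}"
  by (simp add: proper_reduced_power_graph_def)

lemma connectivity_reduced_power_graph: "connectivity (reduced_power_graph G) = 2"
proof (rule connectivity_eqI)
  show "\<not> Digraph_Component.connected
      (reduced_power_graph G \<restriction> (verts (reduced_power_graph G) - {\<one>, z}))"
    using not_connected_without_one_and_z by simp
  fix T assume T: "T \<subseteq> verts (reduced_power_graph G)" "finite T" "card T < 2"
  have "Digraph_Component.connected (reduced_power_graph G \<restriction> (carrier G - T))"
  proof (cases "\<one> \<in> T")
    case True
    then have "T = {\<one>}"
      using T card_le_Suc0_iff_eq[OF T(2)] by auto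
    then show ?thesis using connected_without_one by simp
  qed (auto intro: connected_with_one)
  moreover have "card (carrier G - T) \<noteq> 1"
    using T n by (simp add: card_Diff_subset card_carrier)
  ultimately show "Digraph_Component.connected
        (reduced_power_graph G \<restriction> (verts (reduced_power_graph G) - T)) \<and>
      card (verts (reduced_power_graph G) - T) \<noteq> 1"
    by simp
qed (use z_not_one in auto)

lemma proper_reduced_power_graph_minus:
  "proper_reduced_power_graph G \<restriction> (verts (proper_reduced_power_graph G) - T) =
    reduced_power_graph G \<restriction> (carrier G - insert \<one> T)"
proof -
  have "carrier G - {\<one>} - T = carrier G - insert \<one> T"
    by auto
  then show ?thesis
    unfolding verts_proper proper_reduced_power_graph_def
    using induce_subgraph_induce_subgraph[of "carrier G - insert \<one> T" "carrier G - {\<one>}"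
        "reduced_power_graph G"]
    by auto
qed

lemma connectivity_proper_reduced_power_graph:
  "connectivity (proper_reduced_power_graph G) = 1"
proof (rule connectivity_eqI)
  show "\<not> Digraph_Component.connected
      (proper_reduced_power_graph G \<restriction> (verts (proper_reduced_power_graph G) - {z}))"
    unfolding proper_reduced_power_graph_minus by (rule not_connected_without_one_and_z)
  fix T :: "'a set" assume T: "finite T" "card T < 1"
  then have "T = {}" by simp
  moreover have "card (carrier G - {\<one>}) \<noteq> 1"
    using n by (simp add: card_carrier)
  ultimately show "Digraph_Component.connected
        (proper_reduced_power_graph G \<restriction> (verts (proper_reduced_power_graph G) - T)) \<and>
      card (verts (proper_reduced_power_graph G) - T) \<noteq> 1"
    unfolding proper_reduced_power_graph_minus
    using connected_without_one by (simp add: verts_proper)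
qed (use z_not_one in \<open>auto simp: verts_proper\<close>)

lemma not_hamiltonian_induced:
  assumes "carrier G - H \<subseteq> U"
  shows "\<not> hamiltonian (reduced_power_graph G \<restriction> U)"
proof
  assume "hamiltonian (reduced_power_graph G \<restriction> U)"
  then have "card (carrier G - H) \<le> card {\<one>, z}"
    by (rule hamiltonian_reduced_power_graph_card_le) (use assms dominates_outside_H in auto)
  then show False
    using n by (simp add: card_carrier_minus_H z_not_one[symmetric])
qed

lemma not_hamiltonian_reduced_power_graph: "\<not> hamiltonian (reduced_power_graph G)"
  using not_hamiltonian_induced[of "carrier G"] by (simp add: reduced_power_graph_induced_carrier)

lemma not_hamiltonian_proper_reduced_power_graph:
  "\<not> hamiltonian (proper_reduced_power_graph G)"
  unfolding proper_reduced_power_graph_def by (rule not_hamiltonian_induced) auto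

lemma independence_number_reduced_power_graph_le:
  "independence_number (reduced_power_graph G) \<le>
    2 * n + independence_number (reduced_power_graph (integer_mod_group (2 * n)))"
    (is "_ \<le> 2 * n + ?\<alpha>")
proof -
  obtain S where S: "independent_set (reduced_power_graph G) S"
      "card S = independence_number (reduced_power_graph G)"
    using independence_number_attained[of "reduced_power_graph G"] finite_carrier by auto
  then have "S \<subseteq> carrier G"
    by (simp add: independent_set_def)
  then have "S \<subseteq> (S \<inter> H) \<union> (carrier G - H)"
    by auto
  then have "card S \<le> card ((S \<inter> H) \<union> (carrier G - H))"
    by (rule card_mono[rotated]) (simp add: finite_H finite_carrier)
  also have "\<dots> \<le> card (S \<inter> H) + card (carrier G - H)"
    by (rule card_Un_le)
  also have "card (S \<inter> H) \<le> ?\<alpha>"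
    using card_le_independence_number_cyclic[OF x, of "S \<inter> H"] S(1) n
    by (auto simp: ord_x H_def[symmetric] independent_set_def)
  finally show ?thesis
    by (simp add: card_carrier_minus_H S(2))
qed

text \<open>The subtraction does not truncate, as \<open>n\<close> is positive.\<close>

lemma independence_number_reduced_power_graph_ge:
  "2 * n + independence_number (reduced_power_graph (integer_mod_group (2 * n))) - 1 \<le>
    independence_number (reduced_power_graph G)"
    (is "2 * n + ?\<alpha> - 1 \<le> _")
proof -
  obtain T where T: "independent_set (reduced_power_graph G) T" "T \<subseteq> H" "card T = ?\<alpha>"
    using independence_number_cyclic_attained[OF x] n unfolding ord_x H_def[symmetric] by force
  have finT: "finite T"
    using T(2) finite_H by (rule finite_subset)
  \<comment> \<open>Since \<open>z\<close> and \<open>\<one>\<close> are adjacent, \<open>T\<close> contains at most one of them, and discarding it makes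
    room for all elements outside \<open>H\<close>.\<close>
  have "(z, \<one>) \<in> arcs_ends (reduced_power_graph G)"
    using z_not_one by (intro reduced_power_graph_dominates_one) auto
  then have "T \<inter> {\<one>, z} \<subseteq> {\<one>} \<or> T \<inter> {\<one>, z} \<subseteq> {z}"
    using T(1) by (auto simp: independent_set_def)
  then have "card (T \<inter> {\<one>, z}) \<le> 1"
    by (auto dest: card_mono[rotated])
  then have "?\<alpha> - 1 \<le> card (T - {\<one>, z})"
    using T(3) card_Diff_subset_Int[of T "{\<one>, z}"] by simp
  moreover have "card (T - {\<one>, z} \<union> (carrier G - H)) = card (T - {\<one>, z}) + card (carrier G - H)"
    by (rule card_Un_disjoint) (use finT finite_carrier T(2) in auto)
  moreover have "independent_set (reduced_power_graph G) (T - {\<one>, z} \<union> (carrier G - H))"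
  proof -
    have sym: "(u, v) \<in> arcs_ends (reduced_power_graph G) \<Longrightarrow>
        (v, u) \<in> arcs_ends (reduced_power_graph G)" for u v
      by (auto simp: arcs_ends_reduced_power_graph)
    have "(u, v) \<notin> arcs_ends (reduced_power_graph G)"
      if "u \<in> carrier G - H" "v \<notin> {\<one>, z}" for u v
      using dominates_outside_H that by blast
    moreover have "v \<notin> {\<one>, z}" if "v \<in> carrier G - H" for v
      using that z_in_H by auto
    ultimately show ?thesis
      using T(1) sym unfolding independent_set_def by (simp, blast)
  qed
  ultimately show ?thesis
    using card_le_independence_number[of "reduced_power_graph G"] finite_carrier
    by (fastforce simp: card_carrier_minus_H)
qed

end


section \<open>The presented group is generalized quaternion\<close>

text \<open>The defining relations of \<^const>\<open>quaternion_group\<close>.\<close>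

definition quaternion_relations :: "nat \<Rightarrow> (quat_gen letter list \<times> quat_gen letter list) set" where
  "quaternion_relations n =
    {(replicate (2 * n) (Gen quat_gen.a), []),
     ([], replicate 4 (Gen quat_gen.b)),
     (replicate n (Gen quat_gen.a), replicate 2 (Gen quat_gen.b)),
     ([Gen quat_gen.b, Gen quat_gen.a, Inv quat_gen.b], [Inv quat_gen.a])}"

lemma quaternion_group_eq: "quaternion_group n = presented_group (quaternion_relations n)"
  by (simp add: quaternion_group_def quaternion_relations_def)

text \<open>Left multiplication by a letter on the normal forms \<open>a\<^sup>k b\<^sup>s\<close>, encoded as pairs \<open>(k, s)\<close> with
  \<open>0 \<le> k < 2n\<close> and \<open>s\<close> telling whether the factor \<open>b\<close> is present.\<close>

fun quat_act :: "nat \<Rightarrow> quat_gen letter \<Rightarrow> int \<times> bool \<Rightarrow> int \<times> bool" where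
  "quat_act n (Gen quat_gen.a) (k, s) = ((k + 1) mod (2 * int n), s)"
| "quat_act n (Inv quat_gen.a) (k, s) = ((k - 1) mod (2 * int n), s)"
| "quat_act n (Gen quat_gen.b) (k, s) = ((if s then int n - k else - k) mod (2 * int n), \<not> s)"
| "quat_act n (Inv quat_gen.b) (k, s) = ((if s then - k else int n - k) mod (2 * int n), \<not> s)"

lemma quat_act_range:
  assumes "n > 0" shows "fst (quat_act n l p) \<in> {0..<2 * int n}"
  using assms by (cases "(n, l, p)" rule: quat_act.cases) auto

lemma foldr_quat_act_range:
  assumes "n > 0" "fst p \<in> {0..<2 * int n}"
  shows "fst (foldr (quat_act n) w p) \<in> {0..<2 * int n}"
  using assms quat_act_range[OF assms(1)] by (cases w) auto

lemma quat_act_a_funpow: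
  assumes "k \<in> {0..<2 * int n}"
  shows "(quat_act n (Gen quat_gen.a) ^^ m) (k, s) = ((k + int m) mod (2 * int n), s)"
  using assms by (induction m) (auto simp: mod_simps algebra_simps)

text \<open>The action respects the relations, so it tells the classes of different normal forms apart.\<close>

lemma word_cong_imp_quat_act_eq:
  assumes "(u, v) \<in> word_cong (quaternion_relations n)" and n: "n > 0"
    and "fst p \<in> {0..<2 * int n}"
  shows "foldr (quat_act n) u p = foldr (quat_act n) v p"
  using assms(1,3)
proof (induction arbitrary: p)
  case (cancel l)
  then show ?case
    by (cases "(n, l, p)" rule: quat_act.cases) (auto simp: mod_simps)
next
  case (rel u v)
  obtain k s where p: "p = (k, s)" by (cases p)
  consider "u = replicate (2 * n) (Gen quat_gen.a)" "v = []"
    | "u = []" "v = replicate 4 (Gen quat_gen.b)"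
    | "u = replicate n (Gen quat_gen.a)" "v = replicate 2 (Gen quat_gen.b)"
    | "u = [Gen quat_gen.b, Gen quat_gen.a, Inv quat_gen.b]" "v = [Inv quat_gen.a]"
    using rel(1) by (auto simp: quaternion_relations_def)
  then show ?case
  proof cases
    case 1
    with rel(2) show ?thesis by (simp add: p quat_act_a_funpow)
  next
    case 2
    with rel(2) show ?thesis by (auto simp: p numeral_eq_Suc mod_simps)
  next
    case 3
    have "(k + int n) mod (2 * int n) = (k - int n) mod (2 * int n)"
      by (simp add: mod_eq_dvd_iff)
    with 3 rel(2) show ?thesis
      by (auto simp: p quat_act_a_funpow numeral_2_eq_2 mod_simps algebra_simps)
  next
    case 4
    then show ?thesis by (auto simp: p mod_simps algebra_simps)
  qed
next
  case (append u v u' v')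
  then show ?case using foldr_quat_act_range[OF n, of p v'] by simp
next
  case (sym u v)
  from sym.IH[OF sym.prems] show ?case ..
next
  case (trans u v w)
  from trans.IH(1)[OF trans.prems] trans.IH(2)[OF trans.prems] show ?case
    by (rule HOL.trans)
qed (rule HOL.refl)

lemma word_cong_pow:
  "(word_cong R `` {[l]}) [^]\<^bsub>presented_group R\<^esub> (k::nat) = word_cong R `` {replicate k l}"
  by (induction k)
     (simp_all add: mult_presented_group one_presented_group replicate_append_same)

lemma word_cong_class_eq_iff:
  "word_cong R `` {u} = word_cong R `` {v} \<longleftrightarrow> (u, v) \<in> word_cong R"
  using eq_equiv_class_iff[OF equiv_word_cong, of u v] by simp

lemma inv_word_cong_class:
  "inv\<^bsub>presented_group R\<^esub> (word_cong R `` {[Gen g]}) = word_cong R `` {[Inv g]}"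
proof -
  interpret group "presented_group R" by (rule group_presented_group)
  have "([Inv g, Gen g], []) \<in> word_cong R"
    using word_cong.cancel[of "Inv g"] by simp
  then have "word_cong R `` {[Inv g]} \<otimes>\<^bsub>presented_group R\<^esub> word_cong R `` {[Gen g]} =
      \<one>\<^bsub>presented_group R\<^esub>"
    by (simp add: mult_presented_group one_presented_group word_cong_class_eq_iff)
  then show ?thesis
    by (rule inv_equality) (auto simp: carrier_presented_group)
qed

lemma presented_group_generated:
  "carrier (presented_group R) = generate (presented_group R) (range (\<lambda>g. word_cong R `` {[Gen g]}))"
    (is "_ = generate ?P ?X")
proof
  interpret group ?P by (rule group_presented_group)
  have letter: "word_cong R `` {[l]} \<in> generate ?P ?X" for l
  proof (cases l)
    case (Inv g)
    then show ?thesis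
      using generate.inv[of "word_cong R `` {[Gen g]}" ?X ?P] by (auto simp: inv_word_cong_class)
  qed (auto intro: generate.incl)
  have "word_cong R `` {w} \<in> generate ?P ?X" for w
  proof (induction w)
    case Nil
    show ?case
      unfolding one_presented_group[symmetric] by (rule generate.one)
  next
    case (Cons l w)
    from generate.eng[OF letter[of l] Cons] show ?case
      by (simp add: mult_presented_group)
  qed
  then show "carrier ?P \<subseteq> generate ?P ?X"
    by (auto simp: carrier_presented_group)
  show "generate ?P ?X \<subseteq> carrier ?P"
    by (rule generate_incl) (auto simp: carrier_presented_group)
qed

text \<open>The upper bounds in this proof come from the relations; that the order of \<open>a\<close> is not smaller
  and that \<open>b\<close> is not a power of \<open>a\<close> follow by letting words act on the normal form \<open>a\<^sup>0 b\<^sup>0\<close>.\<close>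

lemma generalized_quaternion_quaternion_group:
  assumes n: "n \<ge> 2"
  shows "generalized_quaternion (quaternion_group n) n
    (word_cong (quaternion_relations n) `` {[Gen quat_gen.a]})
    (word_cong (quaternion_relations n) `` {[Gen quat_gen.b]})"
proof -
  let ?R = "quaternion_relations n"
  let ?cl = "\<lambda>w. word_cong ?R `` {w}"
  interpret group "quaternion_group n"
    unfolding quaternion_group_eq by (rule group_presented_group)
  note simps = mult_presented_group one_presented_group word_cong_class_eq_iff
    word_cong_pow quaternion_group_eq
  have act: "foldr (quat_act n) u (0, False) = foldr (quat_act n) v (0, False)"
    if "(u, v) \<in> word_cong ?R" for u v
    using word_cong_imp_quat_act_eq[OF that] n by simp
  have carr: "?cl w \<in> carrier (quaternion_group n)" for w
    by (auto simp: carrier_presented_group quaternion_group_eq)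
  have rel: "?cl u = ?cl v" if "(u, v) \<in> ?R" for u v
    unfolding word_cong_class_eq_iff using that by (rule word_cong.rel)
  have ord: "ord (?cl [Gen quat_gen.a]) = 2 * n"
  proof -
    have "?cl [Gen quat_gen.a] [^]\<^bsub>quaternion_group n\<^esub> m = \<one>\<^bsub>quaternion_group n\<^esub>
        \<longleftrightarrow> 2 * n dvd m" for m :: nat
    proof
      assume "?cl [Gen quat_gen.a] [^]\<^bsub>quaternion_group n\<^esub> m = \<one>\<^bsub>quaternion_group n\<^esub>"
      then have "(replicate m (Gen quat_gen.a), []) \<in> word_cong ?R"
        by (simp add: simps)
      from act[OF this] have "int m mod (2 * int n) = 0"
        using n by (simp add: quat_act_a_funpow)
      then have "int (2 * n) dvd int m"
        by auto
      then show "2 * n dvd m"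
        by (simp only: int_dvd_int_iff)
    next
      assume "2 * n dvd m"
      moreover have "?cl [Gen quat_gen.a] [^]\<^bsub>quaternion_group n\<^esub> (2 * n) =
          \<one>\<^bsub>quaternion_group n\<^esub>"
        using rel[of "replicate (2 * n) (Gen quat_gen.a)" "[]"]
        by (simp add: simps quaternion_relations_def)
      ultimately show "?cl [Gen quat_gen.a] [^]\<^bsub>quaternion_group n\<^esub> m =
          \<one>\<^bsub>quaternion_group n\<^esub>"
        using carr by (auto simp: nat_pow_pow[symmetric] elim!: dvdE)
    qed
    then show ?thesis
      using ord_unique[OF carr] by blast
  qed
  show ?thesis
  proof
    show "?cl [Gen quat_gen.a] [^]\<^bsub>quaternion_group n\<^esub> n =
        ?cl [Gen quat_gen.b] \<otimes>\<^bsub>quaternion_group n\<^esub> ?cl [Gen quat_gen.b]"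
      using rel[of "replicate n (Gen quat_gen.a)" "replicate 2 (Gen quat_gen.b)"]
      by (simp add: simps quaternion_relations_def numeral_eq_Suc)
    let ?x = "?cl [Gen quat_gen.a]" and ?y = "?cl [Gen quat_gen.b]"
    have "?y \<otimes>\<^bsub>quaternion_group n\<^esub> ?x \<otimes>\<^bsub>quaternion_group n\<^esub> inv\<^bsub>quaternion_group n\<^esub> ?y =
        inv\<^bsub>quaternion_group n\<^esub> ?x"
      using rel[of "[Gen quat_gen.b, Gen quat_gen.a, Inv quat_gen.b]" "[Inv quat_gen.a]"]
      by (simp add: quaternion_group_eq mult_presented_group inv_word_cong_class
          quaternion_relations_def)
    then show "?y \<otimes>\<^bsub>quaternion_group n\<^esub> ?x =
        inv\<^bsub>quaternion_group n\<^esub> ?x \<otimes>\<^bsub>quaternion_group n\<^esub> ?y"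
      using carr inv_solve_right' by (metis inv_closed m_closed)
    show "?y \<notin> generate (quaternion_group n) {?x}"
    proof
      assume "?y \<in> generate (quaternion_group n) {?x}"
      then obtain k :: nat where "?y = ?x [^]\<^bsub>quaternion_group n\<^esub> k"
        using generate_pow_nat[OF carr] ord n by auto
      then have "([Gen quat_gen.b], replicate k (Gen quat_gen.a)) \<in> word_cong ?R"
        by (simp add: simps)
      from act[OF this] show False
        using n by (simp add: quat_act_a_funpow)
    qed
    have UNIV: "(UNIV :: quat_gen set) = {quat_gen.a, quat_gen.b}"
      using quat_gen.exhaust by auto
    have "range (\<lambda>g. ?cl [Gen g]) = {?x, ?y}"
      unfolding UNIV image_insert image_empty ..
    then show "carrier (quaternion_group n) = generate (quaternion_group n) {?x, ?y}"
      using presented_group_generated[of ?R] by (simp add: quaternion_group_eq)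
  qed (use n carr ord in auto)
qed

theorem proposition5p5:
  fixes n :: nat
  assumes "n \<ge> 2"
  shows "(connectivity (reduced_power_graph (quaternion_group n)) = 2 \<and>
          connectivity (proper_reduced_power_graph (quaternion_group n)) = 1) \<and>
         independence_number (reduced_power_graph (quaternion_group n)) \<in>
           {2 * n + independence_number (reduced_power_graph (integer_mod_group (2 * n))) - 1,
            2 * n + independence_number (reduced_power_graph (integer_mod_group (2 * n)))} \<and>
         (\<not> hamiltonian (reduced_power_graph (quaternion_group n)) \<and>
          \<not> hamiltonian (proper_reduced_power_graph (quaternion_group n)))"
proof -
  interpret generalized_quaternion "quaternion_group n" n
    "word_cong (quaternion_relations n) `` {[Gen quat_gen.a]}"
    "word_cong (quaternion_relations n) `` {[Gen quat_gen.b]}"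
    using assms by (rule generalized_quaternion_quaternion_group)
  show ?thesis
  proof (intro conjI)
    show "independence_number (reduced_power_graph (quaternion_group n)) \<in>
        {2 * n + independence_number (reduced_power_graph (integer_mod_group (2 * n))) - 1,
         2 * n + independence_number (reduced_power_graph (integer_mod_group (2 * n)))}"
      using independence_number_reduced_power_graph_le independence_number_reduced_power_graph_ge
      by (simp only: insert_iff empty_iff) linarith
  qed (fact connectivity_reduced_power_graph connectivity_proper_reduced_power_graph
      not_hamiltonian_reduced_power_graph not_hamiltonian_proper_reduced_power_graph)+
qed

end
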